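(* For every positive integer $n$, the number of odd integers $L \in [2^n+1, 2^{n+1}]$ whose chain $C_n(L)$ is an official-Collatz chain or a non-official-Collatz chain is exactly $$\gamma(n) = \sum_{x=1}^{\lfloor (n-1)\log_3 2 \rfloor} \binom{n-1}{x-1} + \sum_{y=\lceil (n-1)\log_3 2 \rceil}^{n-2} \binom{b(y)-1}{a(y)-1} + \sum_{y=\lceil (n-1)\log_3 2\rceil}^{n-3}\ \sum_{x=y+1}^{n-2} \binom{b(x)-1}{a(x)-1}\, N(x,y),$$ where $$b(x) = \left\lfloor \frac{(n-x)\log_2 3 - 1}{\log_2 3 - 1} \right\rfloor, \qquad a(x) = \left\lfloor \frac{n-x-1}{\log_2 3 - 1} \right\rfloor,$$ $$N(x,y) = \sum_{r_1=1}^{w(e)}\ \sum_{r_2=r_1}^{w(e-1)} \cdots \sum_{r_e=r_{e-1}}^{w(1)} 1 \quad \text{with } e = x-y,$$ $$w(s) = w_{x,y}(s) = y+1-a(x) - \left\lceil \frac{s + b(x) - 1 - a(x)\log_2 3}{\log_2 3 - 1} \right\rceil .$$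
   Context: Let $A(x) = 3x+1$ and $B(x) = x/2$. The chain of a positive integer $L$ is obtained by iterating the Collatz rule: if the current number is even, apply $B$; if it is odd, apply $A$ and then $B$. Each such step is called a cell: a cell contains $B$ if the current number is even, and it contains $BA$ if the current number is odd. $C_n(L)$ denotes the chain consisting of the first $n$ cells starting from $L$. For a chain $C$, $\beta(C)$ is the number of functions $B$ in $C$ (which equals its number of cells) and $\alpha(C)$ is the number of functions $A$ in $C$ (which equals the number of cells containing $BA$). A chain $C$ is an official-Collatz chain if $\frac{2^{\beta(C)-1}}{3^{\alpha(C)}} > 1$. A chain $C$ is a non-official-Collatz chain if it does not satisfy this inequality, but it starts with a chain that does, i.e. for some $m$ with $1 \le m < \beta(C)$ the chain $C'$ formed by the first $m$ cells of $C$ satisfies $\frac{2^{\beta(C')-1}}{3^{\alpha(C')}} > 1$. Sums whose upper limit is smaller than the lower limit are $0$. *)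

theory Defs
  imports Complex_Main
begin

datatype collatz_fun = FA | FB

fun eval_fun :: "collatz_fun \<Rightarrow> nat \<Rightarrow> nat" where
  "eval_fun FA x = 3 * x + 1"
| "eval_fun FB x = x div 2"

(* A cell is a composition of functions, written as usual with the function
   applied first on the right: [FB, FA] is BA. *)
type_synonym cell = "collatz_fun list"

definition eval_cell :: "cell \<Rightarrow> nat \<Rightarrow> nat" where
  "eval_cell c x = foldr eval_fun c x"

definition cell_of :: "nat \<Rightarrow> cell" where
  "cell_of x = (if even x then [FB] else [FB, FA])"

(* C_n(L); the cells are listed in the order in which they are applied. *)
fun chain :: "nat \<Rightarrow> nat \<Rightarrow> cell list" where
  "chain 0 L = []"
| "chain (Suc n) L = cell_of L # chain n (eval_cell (cell_of L) L)"

definition alpha :: "cell list \<Rightarrow> nat" where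
  "alpha C = count_list (concat C) FA"

definition beta :: "cell list \<Rightarrow> nat" where
  "beta C = count_list (concat C) FB"

definition official_collatz :: "cell list \<Rightarrow> bool" where
  "official_collatz C \<longleftrightarrow> (2::real) powi (int (beta C) - 1) / 3 ^ alpha C > 1"

definition non_official_collatz :: "cell list \<Rightarrow> bool" where
  "non_official_collatz C \<longleftrightarrow>
     \<not> official_collatz C \<and> (\<exists>m. 1 \<le> m \<and> m < beta C \<and> official_collatz (take m C))"

definition b_fun :: "nat \<Rightarrow> int \<Rightarrow> int" where
  "b_fun n x = \<lfloor>(real_of_int (int n - x) * log 2 3 - 1) / (log 2 3 - 1)\<rfloor>"

definition a_fun :: "nat \<Rightarrow> int \<Rightarrow> int" where
  "a_fun n x = \<lfloor>real_of_int (int n - x - 1) / (log 2 3 - 1)\<rfloor>"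

definition w_fun :: "nat \<Rightarrow> int \<Rightarrow> int \<Rightarrow> nat \<Rightarrow> int" where
  "w_fun n x y s = y + 1 - a_fun n x
     - \<lceil>(real s + real_of_int (b_fun n x) - 1 - real_of_int (a_fun n x) * log 2 3) / (log 2 3 - 1)\<rceil>"

(* nested_sum v e r is the e-fold sum over r_1 in {r..v e}, r_2 in {r_1..v (e-1)},
   ..., r_e in {r_(e-1)..v 1} of the constant 1. *)
fun nested_sum :: "(nat \<Rightarrow> int) \<Rightarrow> nat \<Rightarrow> int \<Rightarrow> nat" where
  "nested_sum v 0 r = 1"
| "nested_sum v (Suc e) r = (\<Sum>q\<in>{r..v (Suc e)}. nested_sum v e q)"

definition N_fun :: "nat \<Rightarrow> int \<Rightarrow> int \<Rightarrow> nat" where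
  "N_fun n x y = nested_sum (w_fun n x y) (nat (x - y)) 1"

(* Summation limits are integers, since n - 2 and n - 3 may be negative. In the last two
   sums n - x \<ge> 2 (resp. n - y \<ge> 2), hence a, b \<ge> 1 there and nat does not truncate. *)
definition gamma :: "nat \<Rightarrow> nat" where
  "gamma n =
     (\<Sum>x\<in>{1..\<lfloor>real_of_int (int n - 1) * log 3 2\<rfloor>}. (n - 1) choose nat (x - 1))
   + (\<Sum>y\<in>{\<lceil>real_of_int (int n - 1) * log 3 2\<rceil>..int n - 2}.
        nat (b_fun n y - 1) choose nat (a_fun n y - 1))
   + (\<Sum>y\<in>{\<lceil>real_of_int (int n - 1) * log 3 2\<rceil>..int n - 3}. \<Sum>x\<in>{y + 1..int n - 2}.
        (nat (b_fun n x - 1) choose nat (a_fun n x - 1)) * N_fun n x y)"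

end

theory Submission
  imports Defs
begin

text \<open>
  The first \<open>n\<close> parities of the iterates determine \<open>L\<close> modulo \<open>2 ^ n\<close>, so the chains of the numbers in
  \<open>{2 ^ n + 1..2 ^ (n + 1)}\<close> are exactly the \<open>2 ^ n\<close> sequences of cells, each attained once.
  A sequence with \<open>k \<ge> 1\<close> cells \<open>BA\<close> and \<open>z\<close> cells \<open>B\<close> is official iff
  \<open>k \<le> a z = \<lfloor>(z - 1) / (log 2 3 - 1)\<rfloor>\<close>; here \<open>log 2 3\<close> is irrational, so equality does not matter.
  Sequences thus become lattice paths in the \<open>(k, z)\<close>-plane. A path that visits the official region but
  ends outside of it leaves the region for the last time at a point \<open>(a i, i)\<close>, by a cell \<open>BA\<close>;
  splitting it there gives the two sums over binomial coefficients, with \<open>x = n - i\<close>.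
\<close>

section \<open>Nested sums and the last-exit decomposition of lattice paths\<close>

text \<open>All summation variables are translated by one. In \<open>escape_count\<close> every
  upper limit grows by one with \<open>k\<close>, so this links \<open>Suc k\<close> to
  \<open>k\<close>.\<close>

lemma nested_sum_shift: "nested_sum (\<lambda>s. v s + 1) e (r + 1) = nested_sum v e r"
proof (induction e arbitrary: r)
  case (Suc e)
  have "{r + 1..v (Suc e) + 1} = (\<lambda>q. q + 1) ` {r..v (Suc e)}"
    by simp
  then show ?case
    by (simp add: sum.reindex inj_on_def Suc del: image_add_atLeastAtMost' image_add_atLeastAtMost)
qed simp

text \<open>The least value \<open>r\<close> of the outermost variable is peeled off; the assumption
  says that this value occurs.\<close>

lemma nested_sum_split:
  assumes "r \<le> v (Suc e)"
  shows "nested_sum v (Suc e) r = nested_sum v e r + nested_sum v (Suc e) (r + 1)"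
proof -
  have "{r..v (Suc e)} = insert r {r + 1..v (Suc e)}"
    using assms by auto
  then show ?thesis
    by simp
qed

text \<open>
  The number of lattice paths from \<open>(a i + 1, i)\<close> to \<open>(k, z)\<close> that stay outside of the region
  \<open>{(k, z). k \<le> a z}\<close>: if \<open>q s\<close> is the first coordinate at which the path takes its \<open>s\<close>-th step in
  the second direction, the summation variables are the numbers \<open>k + 1 - q s\<close>, for decreasing \<open>s\<close>.
\<close>

definition escape_count :: "(nat \<Rightarrow> nat) \<Rightarrow> nat \<Rightarrow> nat \<Rightarrow> nat \<Rightarrow> nat" where
  "escape_count a i k z = nested_sum (\<lambda>s. int k - int (a (i + s))) (z - i) 1"

lemma escape_count_same [simp]: "escape_count a z k z = 1"
  by (simp add: escape_count_def)

text \<open>The upper limit \<open>k - a z\<close> of the outermost sum is at most 0: a path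
  avoiding the region cannot end in it.\<close>

lemma escape_count_boundary:
  assumes "i < z" "k \<le> a z"
  shows "escape_count a i k z = 0"
proof -
  obtain e where e: "z - i = Suc e" "i + Suc e = z"
    using assms(1) by (metis Suc_diff_Suc add_diff_inverse_nat less_imp_le_nat linorder_not_less)
  have "int k - int (a (i + Suc e)) < 1"
    using assms(2) e by simp
  then show ?thesis
    by (simp add: escape_count_def e(1))
qed

text \<open>Paths are sorted by their last step. The outermost variable is 1 exactly if this step is
  in the second direction; the other values, shifted down by one, count the paths ending with a step
  in the first direction.\<close>

lemma escape_count_Suc:
  assumes "i \<le> z" "a (Suc z) \<le> k"
  shows "escape_count a i (Suc k) (Suc z) =
    escape_count a i (Suc k) z + escape_count a i k (Suc z)"
proof -
  let ?v = "\<lambda>s. int k - int (a (i + s))"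
  have e: "Suc z - i = Suc (z - i)" "i + Suc (z - i) = Suc z"
    using assms(1) by auto
  have v: "(\<lambda>s. int (Suc k) - int (a (i + s))) = (\<lambda>s. ?v s + 1)"
    by auto
  have "nested_sum (\<lambda>s. ?v s + 1) (Suc (z - i)) 1 =
      nested_sum (\<lambda>s. ?v s + 1) (z - i) 1 + nested_sum (\<lambda>s. ?v s + 1) (Suc (z - i)) (1 + 1)"
    by (rule nested_sum_split) (use assms e in simp)
  also have "nested_sum (\<lambda>s. ?v s + 1) (Suc (z - i)) (1 + 1) = nested_sum ?v (Suc (z - i)) 1"
    by (rule nested_sum_shift)
  finally show ?thesis
    unfolding escape_count_def v e(1) .
qed

text \<open>Outside of the region both sides obey the same Pascal recursion. The binomial
  coefficient is the value of \<open>f\<close> at the exit point \<open>(a i, i)\<close>. Exits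
  start at \<open>i = 2\<close>, since the region has no point with \<open>k \<ge> 1\<close> and
  \<open>z \<le> 1\<close>.\<close>

lemma last_exit_decomposition:
  fixes f :: "nat \<Rightarrow> nat \<Rightarrow> nat"
  assumes mono: "mono a" and a1: "a 1 = 0" and a_pos: "\<And>z. z \<ge> 2 \<Longrightarrow> a z \<ge> 1"
    and f_inside: "\<And>k z. 1 \<le> k \<Longrightarrow> k \<le> a z \<Longrightarrow> f k z = ((k + z - 1) choose (k - 1))"
    and f_0: "\<And>k. f k 0 = 0" and f_0': "\<And>z. f 0 z = 0"
    and f_outside: "\<And>k z. a (Suc z) \<le> k \<Longrightarrow> f (Suc k) (Suc z) = f k (Suc z) + f (Suc k) z"
    and "a z < k"
  shows "f k z = (\<Sum>i=2..z. ((a i + i - 1) choose (a i - 1)) * escape_count a i k z)"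
  using \<open>a z < k\<close>
proof (induction "k + z" arbitrary: k z rule: less_induct)
  case less
  let ?B = "\<lambda>i. (a i + i - 1) choose (a i - 1)"
  show ?case
  proof (cases z)
    case 0
    then show ?thesis by (simp add: f_0)
  next
    case (Suc z')
    obtain k' where k: "k = Suc k'"
      using less.prems by (cases k) auto
    have a_le: "a z \<le> k'"
      using less.prems k by simp
    have "a z' \<le> a z"
      using mono Suc by (simp add: mono_def)
    then have IH2: "f k z' = (\<Sum>i=2..z'. ?B i * escape_count a i k z')"
      by (intro less.hyps) (use less.prems Suc in auto)
    show ?thesis
    proof (cases "z' = 0")
      case True
      have "f k' 1 = 0"
      proof (cases "k' = 0")
        case False
        then show ?thesis
          using less.hyps[of k' 1] a1 k Suc True by simp
      qed (simp add: f_0')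
      then show ?thesis
        using f_outside[of z' k'] a1 True f_0 k Suc by simp
    next
      case False
      then have z2: "z \<ge> 2" using Suc by simp
      \<comment> \<open>The summand for \<open>i = z\<close> is \<open>?B z\<close> in both cases:
        outside, because \<open>escape_count\<close> is 1 there; on the boundary
        \<open>k' = a z\<close>, because \<open>f k' z\<close> itself is this binomial coefficient
        and all earlier summands vanish.\<close>
      have IH1: "f k' z = (\<Sum>i=2..z'. ?B i * escape_count a i k' z) + ?B z"
      proof (cases "a z < k'")
        case True
        have "f k' z = (\<Sum>i=2..z. ?B i * escape_count a i k' z)"
          by (intro less.hyps) (use True k in auto)
        then show ?thesis
          using z2 Suc by simp
      next
        case False
        then have eq: "k' = a z" using a_le by simp
        have "(\<Sum>i=2..z'. ?B i * escape_count a i k' z) = 0"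
          by (intro sum.neutral ballI) (use eq Suc in \<open>simp add: escape_count_boundary\<close>)
        then show ?thesis
          using f_inside[of k' z] a_pos[OF z2] eq by simp
      qed
      have "f k z = f k' z + f k z'"
        using f_outside[of z' k'] a_le k Suc by simp
      also have "\<dots> = (\<Sum>i=2..z'. ?B i * (escape_count a i k z' + escape_count a i k' z)) + ?B z"
        by (simp add: IH1 IH2 sum.distrib algebra_simps)
      also have "(\<Sum>i=2..z'. ?B i * (escape_count a i k z' + escape_count a i k' z)) =
          (\<Sum>i=2..z'. ?B i * escape_count a i k z)"
        by (intro sum.cong refl) (use a_le k Suc in \<open>simp add: escape_count_Suc\<close>)
      finally show ?thesis
        using z2 Suc by simp
    qed
  qed
qed

section \<open>Cells, chains and residues modulo powers of two\<close>

definition cells :: "cell set" where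
  "cells = {[FB], [FB, FA]}"

lemma alpha_simps [simp]:
  "alpha [] = 0" "alpha (c # C) = count_list c FA + alpha C"
  "alpha (C @ D) = alpha C + alpha D"
  by (auto simp: alpha_def)

lemma beta_lists_cells: "C \<in> lists cells \<Longrightarrow> beta C = length C"
  by (induction C) (auto simp: beta_def cells_def)

lemma alpha_le_length: "C \<in> lists cells \<Longrightarrow> alpha C \<le> length C"
  by (induction C) (auto simp: cells_def)

lemma chain_in_lists_cells: "chain n L \<in> lists cells"
  by (induction n arbitrary: L) (auto simp: cells_def cell_of_def)

lemma length_chain [simp]: "length (chain n L) = n"
  by (induction n arbitrary: L) auto

lemma collatz_step:
  "even L \<Longrightarrow> 2 * eval_cell (cell_of L) L = L"
  "odd L \<Longrightarrow> 2 * eval_cell (cell_of L) L = 3 * L + 1"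
  by (auto simp: eval_cell_def cell_of_def)

text \<open>Equal first cells mean equal parity, so doubling the difference of the successors gives
  \<open>L - M\<close> or \<open>3 * (L - M)\<close>. Each cell thus contributes one factor 2, as 3
  is invertible modulo powers of 2.\<close>

lemma chain_eq_imp_dvd:
  "chain n L = chain n M \<Longrightarrow> (2::int) ^ n dvd int L - int M"
proof (induction n arbitrary: L M)
  case (Suc n)
  let ?L = "eval_cell (cell_of L) L" and ?M = "eval_cell (cell_of M) M"
  have par: "even L \<longleftrightarrow> even M"
    using Suc.prems by (auto simp: cell_of_def split: if_splits)
  have "(2::int) ^ n dvd int ?L - int ?M"
    using Suc.IH Suc.prems by (metis chain.simps(2) list.inject)
  then have d: "(2::int) ^ Suc n dvd int (2 * ?L) - int (2 * ?M)"
    by (metis mult_dvd_mono[OF dvd_refl] of_nat_mult of_nat_numeral power_Suc right_diff_distrib)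
  show ?case
  proof (cases "even L")
    case True
    then show ?thesis
      using d par by (simp only: collatz_step)
  next
    case False
    then have "(2::int) ^ Suc n dvd 3 * (int L - int M)"
      using d par by (simp add: collatz_step algebra_simps)
    moreover have "coprime ((2::int) ^ Suc n) 3"
      by simp
    ultimately show ?thesis
      by (simp only: coprime_dvd_mult_right_iff)
  qed
qed simp

text \<open>Numbers among \<open>2 ^ n\<close> consecutive ones that are congruent modulo
  \<open>2 ^ n\<close> coincide, which gives injectivity; surjectivity follows because both sets
  have \<open>2 ^ n\<close> elements.\<close>

lemma bij_betw_chain:
  "bij_betw (chain n) {2 ^ n + 1..2 ^ (n + 1)} {C \<in> lists cells. length C = n}"
proof -
  have inj: "inj_on (chain n) {2 ^ n + 1..2 ^ (n + 1)}"
  proof (rule inj_onI)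
    fix L M :: nat
    assume L: "L \<in> {2 ^ n + 1..2 ^ (n + 1)}" and M: "M \<in> {2 ^ n + 1..2 ^ (n + 1)}"
      and "chain n L = chain n M"
    then have d: "(2::int) ^ n dvd int L - int M"
      by (simp add: chain_eq_imp_dvd)
    have "int L \<le> int (2 * 2 ^ n)" "int M \<le> int (2 * 2 ^ n)"
        "int (2 ^ n) < int L" "int (2 ^ n) < int M"
      using L M by (simp_all only: of_nat_less_iff of_nat_le_iff) simp_all
    then have "\<bar>int L - int M\<bar> < 2 ^ n"
      unfolding of_nat_mult of_nat_power of_nat_numeral by linarith
    with d show "L = M"
      using dvd_imp_le_int[of "int L - int M" "2 ^ n"] by fastforce
  qed
  have sub: "chain n ` {2 ^ n + 1..2 ^ (n + 1)} \<subseteq> {C \<in> lists cells. length C = n}"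
    using chain_in_lists_cells by auto
  have card_cells: "card cells = 2"
    by (simp add: cells_def)
  have fin: "finite cells"
    by (simp add: cells_def)
  have eq: "{C \<in> lists cells. length C = n} = {C. set C \<subseteq> cells \<and> length C = n}"
    by auto
  have "card (chain n ` {2 ^ n + 1..2 ^ (n + 1)}) = card {C \<in> lists cells. length C = n}"
    unfolding eq card_image[OF inj] card_lists_length_eq[OF fin]
    using card_cells by simp
  then show ?thesis
    unfolding bij_betw_def using inj sub card_subset_eq finite_lists_length_eq[OF fin, of n] eq
    by metis
qed

lemma card_lists_cells:
  "card {C \<in> lists cells. length C = m \<and> alpha C = k} = m choose k"
proof (induction m arbitrary: k)
  case 0
  have "{C \<in> lists cells. length C = 0 \<and> alpha C = k} = (if k = 0 then {[]} else {})"
    by auto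
  then show ?case by simp
next
  case (Suc m)
  let ?S = "\<lambda>m k. {C \<in> lists cells. length C = m \<and> alpha C = k}"
  have fin: "finite (?S m k)" for m k
    by (rule finite_subset[OF _ finite_lists_length_eq[of cells m]]) (auto simp: cells_def)
  show ?case
  proof (cases k)
    case 0
    have "?S (Suc m) 0 = Cons [FB] ` ?S m 0"
      by (auto simp: length_Suc_conv cells_def image_iff)
    then show ?thesis
      using 0 Suc by (simp add: card_image)
  next
    case (Suc k')
    have "?S (Suc m) k = Cons [FB] ` ?S m k \<union> Cons [FB, FA] ` ?S m k'"
      using Suc by (auto simp: length_Suc_conv cells_def image_iff)
    also have "card \<dots> = card (?S m k) + card (?S m k')"
      by (subst card_Un_disjoint) (auto simp: fin card_image)
    finally show ?thesis
      using Suc.IH Suc by simp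
  qed
qed

section \<open>Chains with an official prefix\<close>

text \<open>Here the prefix may be the whole chain, so that both kinds of chains are covered at once
  and the property persists when cells are appended.\<close>

definition hits :: "cell list \<Rightarrow> bool" where
  "hits C \<longleftrightarrow> (\<exists>m. 1 \<le> m \<and> m \<le> length C \<and> official_collatz (take m C))"

lemma hits_snoc: "hits (C @ [c]) \<longleftrightarrow> hits C \<or> official_collatz (C @ [c])"
  unfolding hits_def by (auto simp: le_Suc_eq)

lemma hits_if_official: "official_collatz C \<Longrightarrow> C \<noteq> [] \<Longrightarrow> hits C"
  unfolding hits_def by (intro exI[of _ "length C"]) (cases C; simp)

lemma official_or_non_official_iff_hits:
  assumes "C \<in> lists cells" "C \<noteq> []"
  shows "official_collatz C \<or> non_official_collatz C \<longleftrightarrow> hits C"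
  using assms hits_if_official[of C]
  unfolding non_official_collatz_def hits_def beta_lists_cells[OF assms(1)]
  by (metis le_eq_less_or_eq take_all_iff)

section \<open>Irrationality of \<open>log 2 3\<close> and the official region\<close>

lemma three_power_neq_two_power: "0 < k \<Longrightarrow> (3::nat) ^ k \<noteq> 2 ^ m"
  by (cases m) (auto, metis even_mult_iff even_numeral even_power odd_numeral)

text \<open>Taking logarithms in \<open>2 ^ (k + z - 1) > 3 ^ k\<close> gives
  \<open>k * slope < z - 1\<close>: this is the slope of the line bounding the official
  region.\<close>

abbreviation slope :: real where
  "slope \<equiv> log 2 3 - 1"

lemma slope_pos: "0 < slope" and slope_less_1: "slope < 1"
proof -
  show "0 < slope" by simp
  have "log 2 3 < log 2 4" by simp
  also have "log 2 4 = log 2 ((2::real) ^ 2)" by simp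
  also have "\<dots> = 2" by (subst log_nat_power) auto
  finally show "slope < 1" by simp
qed

lemma log_2_3_neq_1: "log 2 3 \<noteq> (1::real)"
  using slope_pos by linarith

text \<open>Irrationality of \<open>log 2 3\<close> in the form used below: equality would give
  \<open>3 ^ k = 2 ^ m\<close>.\<close>

lemma of_nat_mult_log_neq: "0 < k \<Longrightarrow> real k * log 2 3 \<noteq> real m"
proof
  assume "0 < k" and eq: "real k * log 2 3 = real m"
  have "log 2 (3 ^ k) = real m"
    using eq by (simp add: log_nat_power)
  then have "(3::real) ^ k = 2 powr real m"
    by (metis log_powr_cancel powr_log_cancel one_less_numeral_iff semiring_norm(76) zero_less_numeral
        zero_less_power numeral_eq_one_iff semiring_norm(85))
  then have "real (3 ^ k) = real (2 ^ m)"
    by (simp add: powr_realpow)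
  then have "(3::nat) ^ k = 2 ^ m"
    by (simp only: of_nat_eq_iff)
  then show False
    using three_power_neq_two_power[OF \<open>0 < k\<close>] by simp
qed

text \<open>The boundary \<open>a z\<close> of the official region. For \<open>z = 0\<close> the
  floor is negative and \<open>nat\<close> turns it into 0.\<close>

definition max_odd :: "nat \<Rightarrow> nat" where
  "max_odd z = nat \<lfloor>(real z - 1) / slope\<rfloor>"

lemma mono_max_odd: "mono max_odd"
  unfolding max_odd_def using slope_pos
  by (intro monoI nat_mono floor_mono divide_right_mono) auto

lemma max_odd_1: "max_odd 1 = 0"
  by (simp add: max_odd_def)

lemma max_odd_0: "max_odd 0 = 0"
  using monoD[OF mono_max_odd, of 0 1] max_odd_1 by simp

lemma max_odd_pos: "z \<ge> 2 \<Longrightarrow> max_odd z \<ge> 1"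
proof -
  assume "z \<ge> 2"
  then have "1 \<le> (real z - 1) / slope"
    using slope_pos slope_less_1 by (simp add: field_simps)
  then have "1 \<le> \<lfloor>(real z - 1) / slope\<rfloor>"
    by (simp add: le_floor_iff)
  then show ?thesis
    unfolding max_odd_def by linarith
qed

lemma int_max_odd: "1 \<le> z \<Longrightarrow> int (max_odd z) = \<lfloor>(real z - 1) / slope\<rfloor>"
  unfolding max_odd_def using slope_pos by (intro int_nat_eq[THEN trans]) auto

lemma le_max_odd_iff:
  assumes "1 \<le> k"
  shows "k \<le> max_odd z \<longleftrightarrow> real k * log 2 3 < real (k + z) - 1"
proof -
  have "k \<le> max_odd z \<longleftrightarrow> int k \<le> \<lfloor>(real z - 1) / slope\<rfloor>"
    unfolding max_odd_def using assms by linarith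
  also have "\<dots> \<longleftrightarrow> real k * log 2 3 \<le> real (k + z) - 1"
    using slope_pos by (simp add: le_floor_iff pos_le_divide_eq algebra_simps)
  \<comment> \<open>The floor only yields a weak inequality; equality is excluded by
    irrationality.\<close>
  also have "\<dots> \<longleftrightarrow> real k * log 2 3 < real (k + z) - 1"
    using of_nat_mult_log_neq[of k "k + z - 1"] assms by (auto simp: of_nat_diff)
  finally show ?thesis .
qed

lemma official_iff_le_max_odd:
  assumes "C \<in> lists cells" "1 \<le> alpha C" "length C = alpha C + z"
  shows "official_collatz C \<longleftrightarrow> alpha C \<le> max_odd z"
proof -
  let ?k = "alpha C"
  have "official_collatz C \<longleftrightarrow> (3::real) ^ ?k < 2 ^ (?k + z - 1)"
    unfolding official_collatz_def beta_lists_cells[OF assms(1)] assms(3)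
    using assms(2) by (simp add: power_int_def nat_diff_distrib nat_add_distrib)
  also have "\<dots> \<longleftrightarrow> log 2 (3 ^ ?k) < log 2 (2 ^ (?k + z - 1))"
    by (subst log_less_cancel_iff) auto
  also have "\<dots> \<longleftrightarrow> real ?k * log 2 3 < real (?k + z) - 1"
    using assms(2) by (simp add: log_nat_power of_nat_diff)
  finally show ?thesis
    using le_max_odd_iff[OF assms(2)] by simp
qed

section \<open>Counting hitting chains\<close>

text \<open>The first cell \<open>BA\<close> encodes an odd starting number; \<open>z\<close> is the
  number of cells \<open>B\<close>.\<close>

definition odd_chains :: "nat \<Rightarrow> nat \<Rightarrow> cell list set" where
  "odd_chains k z = {C \<in> lists cells. C \<noteq> [] \<and> hd C = [FB, FA] \<and> alpha C = k \<and> length C = k + z}"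

definition hitting_chains :: "nat \<Rightarrow> nat \<Rightarrow> cell list set" where
  "hitting_chains k z = {C \<in> odd_chains k z. hits C}"

lemma alpha_pos: "C \<in> odd_chains k z \<Longrightarrow> 1 \<le> alpha C"
  by (cases C) (auto simp: odd_chains_def)

lemma finite_odd_chains: "finite (odd_chains k z)"
  by (rule finite_subset[OF _ finite_lists_length_eq[of cells "k + z"]])
     (auto simp: odd_chains_def cells_def)

lemma finite_hitting_chains: "finite (hitting_chains k z)"
  by (simp add: hitting_chains_def finite_odd_chains)

lemma card_odd_chains:
  assumes "1 \<le> k"
  shows "card (odd_chains k z) = (k + z - 1) choose (k - 1)"
proof -
  have "odd_chains k z = Cons [FB, FA] ` {C \<in> lists cells. length C = k + z - 1 \<and> alpha C = k - 1}"
    (is "_ = Cons _ ` ?S")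
  proof (intro equalityI subsetI)
    fix C assume C: "C \<in> odd_chains k z"
    then show "C \<in> Cons [FB, FA] ` ?S"
      by (cases C) (auto simp: odd_chains_def)
  next
    fix C assume "C \<in> Cons [FB, FA] ` ?S"
    then show "C \<in> odd_chains k z"
      using assms by (auto simp: odd_chains_def cells_def)
  qed
  then show ?thesis
    by (simp add: card_image card_lists_cells)
qed

text \<open>A chain ending in the region is itself official, so all of them hit.\<close>

lemma card_hitting_chains_inside:
  assumes "1 \<le> k" "k \<le> max_odd z"
  shows "card (hitting_chains k z) = (k + z - 1) choose (k - 1)"
proof -
  have "hits C" if "C \<in> odd_chains k z" for C
    using that official_iff_le_max_odd[of C z] assms
    by (intro hits_if_official) (auto simp: odd_chains_def)
  then have "hitting_chains k z = odd_chains k z"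
    by (auto simp: hitting_chains_def)
  then show ?thesis
    using card_odd_chains[OF assms(1)] by simp
qed

lemma hitting_chains_0_left: "hitting_chains 0 z = {}"
  using alpha_pos by (fastforce simp: hitting_chains_def odd_chains_def)

text \<open>With only cells \<open>BA\<close>, an official prefix of \<open>m\<close> cells would
  require \<open>m * log 2 3 < m - 1\<close>, although \<open>log 2 3 \<ge> 1\<close>.\<close>

lemma hitting_chains_0_right: "hitting_chains k 0 = {}"
proof -
  have False if C: "C \<in> odd_chains k 0" and m: "1 \<le> m" "m \<le> length C"
    and off: "official_collatz (take m C)" for C m
  proof -
    have cells: "take m C \<in> lists cells" "drop m C \<in> lists cells"
      using C by (auto simp: odd_chains_def dest: in_set_takeD in_set_dropD)
    \<comment> \<open>The total attains the bound \<open>alpha_le_length\<close>, so both parts must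
      attain it.\<close>
    have "alpha (take m C) + alpha (drop m C) = length C"
      using C by (metis (mono_tags, lifting) add_0_right alpha_simps(3) append_take_drop_id
          mem_Collect_eq odd_chains_def)
    then have "alpha (take m C) = m"
      using alpha_le_length[OF cells(1)] alpha_le_length[OF cells(2)] m by simp
    moreover have "real m * 1 \<le> real m * log 2 3"
      by (rule mult_left_mono) auto
    then have "\<not> real m * log 2 3 < real m - 1"
      by linarith
    ultimately show False
      using official_iff_le_max_odd[OF cells(1), of 0] off m
      by (simp add: le_max_odd_iff)
  qed
  then show ?thesis
    unfolding hitting_chains_def hits_def by blast
qed

text \<open>The last cell is removed. The full chain ends outside of the region and is not official,
  so the hit already occurs in what remains.\<close>

lemma card_hitting_chains_outside:
  assumes "max_odd (Suc z) \<le> k"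
  shows "card (hitting_chains (Suc k) (Suc z)) =
    card (hitting_chains k (Suc z)) + card (hitting_chains (Suc k) z)"
proof -
  let ?A = "(\<lambda>C. C @ [[FB, FA]]) ` hitting_chains k (Suc z)"
  let ?B = "(\<lambda>C. C @ [[FB]]) ` hitting_chains (Suc k) z"
  have "hitting_chains (Suc k) (Suc z) = ?A \<union> ?B"
  proof (intro equalityI subsetI)
    fix C assume C: "C \<in> hitting_chains (Suc k) (Suc z)"
    then obtain D c where D: "C = D @ [c]"
      by (cases C rule: rev_cases) (auto simp: hitting_chains_def odd_chains_def)
    \<comment> \<open>The chain has at least two cells, so removing the last one keeps the first
      cell \<open>BA\<close>.\<close>
    have "D \<noteq> []"
      using C D by (auto simp: hitting_chains_def odd_chains_def)
    moreover have "\<not> official_collatz C"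
      using C assms official_iff_le_max_odd[of C "Suc z"]
      by (auto simp: hitting_chains_def odd_chains_def)
    ultimately show "C \<in> ?A \<union> ?B"
      using C D by (auto simp: hitting_chains_def odd_chains_def hits_snoc cells_def)
  next
    fix C assume "C \<in> ?A \<union> ?B"
    then show "C \<in> hitting_chains (Suc k) (Suc z)"
      by (auto simp: hitting_chains_def odd_chains_def hits_snoc cells_def)
  qed
  also have "card \<dots> = card ?A + card ?B"
    by (rule card_Un_disjoint) (auto simp: finite_hitting_chains)
  finally show ?thesis
    by (simp add: card_image inj_on_def)
qed

lemma card_hitting_chains_nonofficial:
  assumes "max_odd z < k"
  shows "card (hitting_chains k z) =
    (\<Sum>i=2..z. ((max_odd i + i - 1) choose (max_odd i - 1)) * escape_count max_odd i k z)"
  using mono_max_odd max_odd_1 max_odd_pos card_hitting_chains_inside _ _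
    card_hitting_chains_outside assms
  by (rule last_exit_decomposition[where f = "\<lambda>k z. card (hitting_chains k z)"])
     (simp_all add: hitting_chains_0_left hitting_chains_0_right)

text \<open>The bijection \<open>chain n\<close> moves the count to sequences of cells, which are
  then sorted by their number \<open>k\<close> of cells \<open>BA\<close>.\<close>

lemma card_eq_sum_hitting_chains:
  assumes "1 \<le> n"
  shows "card {L. odd L \<and> L \<in> {2 ^ n + 1..2 ^ (n + 1)} \<and>
      (official_collatz (chain n L) \<or> non_official_collatz (chain n L))} =
    (\<Sum>k=1..n. card (hitting_chains k (n - k)))"
proof -
  let ?T = "{C \<in> lists cells. length C = n \<and> hd C = [FB, FA] \<and> hits C}"
  have hd: "odd L \<longleftrightarrow> hd (chain n L) = [FB, FA]" for L
    using assms by (cases n) (auto simp: cell_of_def)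
  have ne: "chain n L \<noteq> []" for L
    using assms by (metis length_chain list.size(3) not_one_le_zero)
  have eq: "{L. odd L \<and> L \<in> {2 ^ n + 1..2 ^ (n + 1)} \<and>
      (official_collatz (chain n L) \<or> non_official_collatz (chain n L))} =
    {L \<in> {2 ^ n + 1..2 ^ (n + 1)}. hd (chain n L) = [FB, FA] \<and> hits (chain n L)}"
    (is "_ = ?S")
    using official_or_non_official_iff_hits[OF chain_in_lists_cells ne] hd by blast
  have "bij_betw (chain n) ?S ?T"
    using bij_betw_Collect[OF bij_betw_chain[of n],
        of "\<lambda>C. hd C = [FB, FA] \<and> hits C" "\<lambda>L. hd (chain n L) = [FB, FA] \<and> hits (chain n L)"]
    by (simp add: conj_assoc)
  then have "card ?S = card ?T"
    by (rule bij_betw_same_card)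
  also have "?T = (\<Union>k\<in>{1..n}. hitting_chains k (n - k))"
  proof (intro equalityI subsetI)
    fix C assume C: "C \<in> ?T"
    then have ne: "C \<noteq> []" using assms by auto
    then have "1 \<le> alpha C" "alpha C \<le> n"
      using C alpha_le_length[of C] by (cases C; auto)+
    then show "C \<in> (\<Union>k\<in>{1..n}. hitting_chains k (n - k))"
      using C ne by (auto simp: hitting_chains_def odd_chains_def)
  next
    fix C assume "C \<in> (\<Union>k\<in>{1..n}. hitting_chains k (n - k))"
    then show "C \<in> ?T"
      by (auto simp: hitting_chains_def odd_chains_def)
  qed
  also have "card \<dots> = (\<Sum>k=1..n. card (hitting_chains k (n - k)))"
    by (intro card_UN_disjoint ballI impI finite_hitting_chains)
       (auto simp: hitting_chains_def odd_chains_def)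
  finally show ?thesis
    using eq by simp
qed

section \<open>The functions a, b, w and N in terms of the region\<close>

lemma a_fun_eq_max_odd:
  assumes "1 \<le> i"
  shows "a_fun n (int n - int i) = int (max_odd i)"
  unfolding a_fun_def by (simp add: int_max_odd[OF assms])

text \<open>The quotients defining \<open>b\<close> and \<open>a\<close> differ by exactly
  \<open>i\<close>, so \<open>b\<close> is the number of cells up to the exit point
  \<open>(max_odd i, i)\<close>.\<close>

lemma b_fun_eq_max_odd:
  assumes "1 \<le> i"
  shows "b_fun n (int n - int i) = int (max_odd i + i)"
proof -
  have "(real i * log 2 3 - 1) / slope = (real i - 1) / slope + of_int (int i)"
    by (simp add: divide_simps log_2_3_neq_1) (simp add: algebra_simps)
  then show ?thesis
    unfolding b_fun_def by (simp only: floor_add_int[symmetric] diff_diff_eq2) (simp add: int_max_odd[OF assms])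
qed

text \<open>A value \<open>j\<close> of the quotient would give \<open>j * log 2 3 = m + j\<close>,
  against irrationality.\<close>

lemma divide_slope_not_Int:
  assumes "1 \<le> m"
  shows "real m / slope \<notin> \<int>"
proof
  assume "real m / slope \<in> \<int>"
  then obtain j where j: "real m / slope = of_int j"
    by (auto elim: Ints_cases)
  then have eq: "real m = of_int j * slope"
    using slope_pos by (simp add: field_simps)
  have "0 < j"
    using j slope_pos assms by (metis divide_pos_pos of_int_0_less_iff of_nat_0_less_iff
        less_le_trans zero_less_one)
  then have "real (nat j) * log 2 3 = real (m + nat j)"
    using eq by (simp add: algebra_simps)
  then show False
    using of_nat_mult_log_neq[of "nat j" "m + nat j"] \<open>0 < j\<close> by simp
qed

lemma ceiling_eq_floor_plus_1: "(t::real) \<notin> \<int> \<Longrightarrow> \<lceil>t\<rceil> = \<lfloor>t\<rfloor> + 1"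
  by (metis Ints_of_int ceiling_altdef)

text \<open>The numerator in \<open>w\<close> is \<open>(i + s - 1) - max_odd i * slope\<close>, so
  \<open>max_odd i\<close> cancels. The ceiling of a non-integer exceeds its floor by one, which
  absorbs the 1 in \<open>y + 1\<close>.\<close>

lemma w_fun_eq_max_odd:
  assumes "1 \<le> i" "1 \<le> s"
  shows "w_fun n (int n - int i) y s = y - int (max_odd (i + s))"
proof -
  let ?t = "real (i + s - 1) / slope"
  have i: "real (i + s - 1) = real i + real s - 1"
    using assms by (simp add: of_nat_diff)
  have eq: "(real s + real (max_odd i + i) - 1 - real (max_odd i) * log 2 3) / slope
      = ?t - of_int (int (max_odd i))"
    using i by (simp add: divide_simps log_2_3_neq_1) (simp add: algebra_simps)
  then have "w_fun n (int n - int i) y s = y + 1 - \<lceil>?t\<rceil>"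
    unfolding w_fun_def a_fun_eq_max_odd[OF assms(1)] b_fun_eq_max_odd[OF assms(1)]
      of_int_of_nat_eq
    unfolding eq ceiling_diff_of_int by simp
  also have "\<lceil>?t\<rceil> = \<lfloor>?t\<rfloor> + 1"
    using assms by (intro ceiling_eq_floor_plus_1 divide_slope_not_Int) simp
  also have "\<lfloor>?t\<rfloor> = int (max_odd (i + s))"
    using int_max_odd[of "i + s"] assms i by simp
  finally show ?thesis by simp
qed

lemma nested_sum_cong:
  "(\<And>s. 1 \<le> s \<Longrightarrow> s \<le> e \<Longrightarrow> v s = w s) \<Longrightarrow> nested_sum v e r = nested_sum w e r"
  by (induction e arbitrary: r) auto

text \<open>For \<open>y = k\<close> the limits \<open>w\<close> are those of
  \<open>escape_count\<close>, and the depth \<open>x - y\<close> is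
  \<open>n - k - i\<close>.\<close>

lemma N_fun_eq_escape_count:
  assumes "1 \<le> i" "i \<le> n - k" "k \<le> n"
  shows "N_fun n (int n - int i) (int k) = escape_count max_odd i k (n - k)"
proof -
  have "nat (int n - int i - int k) = n - k - i"
    using assms by linarith
  then show ?thesis
    unfolding N_fun_def escape_count_def
    using assms by (auto intro!: nested_sum_cong simp: w_fun_eq_max_odd)
qed

lemma hitting_count_eq_last_exit_sum:
  assumes k: "max_odd (n - k) < k" "k + 2 \<le> n"
  shows "card (hitting_chains k (n - k)) =
      (nat (b_fun n (int k) - 1) choose nat (a_fun n (int k) - 1)) +
      (\<Sum>x\<in>{int k + 1..int n - 2}.
        (nat (b_fun n x - 1) choose nat (a_fun n x - 1)) * N_fun n x (int k))"
proof -
  let ?B = "\<lambda>i. (max_odd i + i - 1) choose (max_odd i - 1)"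
  let ?b = "\<lambda>x. nat (b_fun n x - 1) choose nat (a_fun n x - 1)"
  have B: "?b (int n - int i) = ?B i" if "1 \<le> i" for i
  proof -
    have "nat (int (max_odd i + i) - 1) = max_odd i + i - 1" "nat (int (max_odd i) - 1) = max_odd i - 1"
      by linarith+
    then show ?thesis
      by (simp only: a_fun_eq_max_odd[OF that] b_fun_eq_max_odd[OF that])
  qed
  obtain z where z: "n - k = Suc z" "1 \<le> z"
    using k(2) by (cases "n - k") auto
  have kz: "int k = int n - int (Suc z)"
    using z k by linarith
  have "card (hitting_chains k (n - k)) = (\<Sum>i=2..Suc z. ?B i * escape_count max_odd i k (Suc z))"
    using card_hitting_chains_nonofficial[OF k(1)] z by simp
  \<comment> \<open>The summand \<open>i = n - k\<close> is an exit by the very last cell or along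
    cells \<open>BA\<close> only, and has \<open>escape_count\<close> 1. The others, with
    \<open>x = n - i\<close>, fill the range from \<open>k + 1\<close> to
    \<open>n - 2\<close>.\<close>
  also have "\<dots> = ?B (Suc z) + (\<Sum>i=2..z. ?B i * escape_count max_odd i k (Suc z))"
    using z by simp
  also have "?B (Suc z) = ?b (int k)"
    unfolding kz by (rule B[symmetric]) simp
  also have "(\<Sum>i=2..z. ?B i * escape_count max_odd i k (Suc z)) =
      (\<Sum>x\<in>{int k + 1..int n - 2}. ?b x * N_fun n x (int k))"
  proof (rule sum.reindex_bij_witness[where i = "\<lambda>x. nat (int n - x)" and j = "\<lambda>i. int n - int i"])
    fix i assume "i \<in> {2..z}"
    then have i: "1 \<le> i" "i \<le> n - k" "k \<le> n"
      using z by auto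
    show "?b (int n - int i) * N_fun n (int n - int i) (int k) =
        ?B i * escape_count max_odd i k (Suc z)"
      by (simp only: B[OF i(1)] N_fun_eq_escape_count[OF i] z(1))
  qed (use kz k in auto)
  finally show ?thesis .
qed

section \<open>Limits of summation and the final count\<close>

lemma log_3_2: "log 3 2 = 1 / log 2 (3::real)"
  by (simp add: log_def)

text \<open>On the line \<open>k + z = n\<close> the region is \<open>k * log 2 3 < n - 1\<close>;
  hence the limit of the first sum.\<close>

lemma le_floor_log_iff:
  assumes "1 \<le> k" "k \<le> n"
  shows "int k \<le> \<lfloor>real_of_int (int n - 1) * log 3 2\<rfloor> \<longleftrightarrow> k \<le> max_odd (n - k)"
proof -
  have "int k \<le> \<lfloor>real_of_int (int n - 1) * log 3 2\<rfloor> \<longleftrightarrow> real k * log 2 3 \<le> real n - 1"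
    by (simp add: le_floor_iff log_3_2 pos_le_divide_eq)
  also have "\<dots> \<longleftrightarrow> real k * log 2 3 < real n - 1"
    using of_nat_mult_log_neq[of k "n - 1"] assms by (auto simp: of_nat_diff)
  finally show ?thesis
    using assms by (simp add: le_max_odd_iff)
qed

lemma ceiling_log_eq:
  assumes "2 \<le> n"
  shows "\<lceil>real_of_int (int n - 1) * log 3 2\<rceil> = \<lfloor>real_of_int (int n - 1) * log 3 2\<rfloor> + 1"
proof (rule ceiling_eq_floor_plus_1, rule notI)
  assume "real_of_int (int n - 1) * log 3 2 \<in> \<int>"
  then obtain j where "real_of_int (int n - 1) * log 3 2 = of_int j"
    by (auto elim: Ints_cases)
  moreover have "log 2 3 \<noteq> (0::real)"
    using slope_pos by linarith
  ultimately have eq: "real (n - 1) = of_int j * log 2 3"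
    using assms nonzero_divide_eq_eq[of "log 2 3" "real n - 1" "of_int j"]
    by (simp add: log_3_2 of_nat_diff)
  then have "0 < of_int j * log 2 (3::real)"
    using assms by linarith
  then have "0 < j"
    by (simp add: zero_less_mult_iff)
  then show False
    using of_nat_mult_log_neq[of "nat j" "n - 1"] eq by simp
qed

theorem mainTheorem3:
  fixes n :: nat
  assumes "n \<ge> 1"
  shows "card {L :: nat. odd L \<and> L \<in> {2 ^ n + 1..2 ^ (n + 1)} \<and>
           (official_collatz (chain n L) \<or> non_official_collatz (chain n L))} = gamma n"
proof -
  let ?F = "\<lfloor>real_of_int (int n - 1) * log 3 2\<rfloor>" and ?C = "\<lceil>real_of_int (int n - 1) * log 3 2\<rceil>"
  let ?h = "\<lambda>k. card (hitting_chains k (n - k))"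
  let ?G = "\<lambda>y. nat (b_fun n y - 1) choose nat (a_fun n y - 1)"
  let ?H = "\<lambda>y. \<Sum>x\<in>{y + 1..int n - 2}. ?G x * N_fun n x y"
  define p where "p = nat ?F"
  have F: "?F = int p"
    unfolding p_def using assms by (simp add: log_3_2)
  have inside: "k \<le> max_odd (n - k) \<longleftrightarrow> k \<le> p" if "1 \<le> k" "k \<le> n" for k
    using le_floor_log_iff[OF that] unfolding F by simp
  \<comment> \<open>At \<open>k = n\<close> there is no cell \<open>B\<close> and
    \<open>max_odd 0 = 0\<close>.\<close>
  have "p < n"
    using inside[of n] assms max_odd_0 by auto
  have C: "{?C..int n - 2} = {int (p + 1)..int (n - 2)}"
  \<comment> \<open>For \<open>n = 1\<close> the bound is the integer 0, so ceiling and floor agree;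
    both intervals are empty then.\<close>
  proof (cases "n = 1")
    case False
    then show ?thesis
      using ceiling_log_eq[of n] assms unfolding F by (simp add: of_nat_diff)
  qed auto
  have "(\<Sum>k=1..n. ?h k) = (\<Sum>k=1..p. ?h k) + (\<Sum>k=p + 1..n. ?h k)"
    using \<open>p < n\<close> sum.ub_add_nat[of 1 p ?h "n - p"] by simp
  also have "(\<Sum>k=1..p. ?h k) = (\<Sum>x\<in>{1..?F}. (n - 1) choose nat (x - 1))"
    unfolding F
  proof (rule sum.reindex_bij_witness[where i = nat and j = int])
    fix k assume "k \<in> {1..p}"
    then show "(n - 1) choose nat (int k - 1) = ?h k"
      using inside[of k] card_hitting_chains_inside[of k "n - k"] \<open>p < n\<close>
      by (simp add: nat_diff_distrib)
  qed auto
  \<comment> \<open>For \<open>k > n - 2\<close> at most one cell is \<open>B\<close>, and the sum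
    over exits from \<open>i = 2\<close> is empty.\<close>
  also have "(\<Sum>k=p + 1..n. ?h k) = (\<Sum>k=p + 1..n - 2. ?h k)"
  proof (rule sum.mono_neutral_right)
    show "\<forall>k\<in>{p + 1..n} - {p + 1..n - 2}. ?h k = 0"
    proof
      fix k assume k: "k \<in> {p + 1..n} - {p + 1..n - 2}"
      then have "n - k < 2" by auto
      then show "?h k = 0"
        using k inside[of k] card_hitting_chains_nonofficial[of "n - k" k] by auto
    qed
  qed auto
  also have "\<dots> = (\<Sum>y\<in>{?C..int n - 2}. ?G y + ?H y)"
    unfolding C
  proof (rule sum.reindex_bij_witness[where i = nat and j = int])
    fix k assume "k \<in> {p + 1..n - 2}"
    then have k: "1 \<le> k" "k + 2 \<le> n" "\<not> k \<le> p"
      by auto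
    then have "max_odd (n - k) < k"
      using inside[of k] by simp
    then show "?G (int k) + ?H (int k) = ?h k"
      using hitting_count_eq_last_exit_sum[of n k] k(2) by simp
  qed auto
  also have "\<dots> = (\<Sum>y\<in>{?C..int n - 2}. ?G y) + (\<Sum>y\<in>{?C..int n - 2}. ?H y)"
    by (rule sum.distrib)
  \<comment> \<open>At \<open>y = n - 2\<close> the inner range from \<open>n - 1\<close> to
    \<open>n - 2\<close> is empty.\<close>
  also have "(\<Sum>y\<in>{?C..int n - 2}. ?H y) = (\<Sum>y\<in>{?C..int n - 3}. ?H y)"
    by (rule sum.mono_neutral_right) auto
  finally show ?thesis
    unfolding card_eq_sum_hitting_chains[OF assms] gamma_def by simp
qed

end
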